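(* Assume that there are an involution $\sigma$ of the set of reset sites ($\sigma^2=\mathrm{id}$), with at least one site $z$ such that $\sigma(z)\neq z$, and weights $\kappa(z)>0$ independent of $\nu$, such that $B_\nu(z)=\kappa(z)A_\nu(\sigma(z))$ for all $\nu$ and all reset sites $z$. Assume in addition that the spectral coefficients satisfy the parity condition: for each spectral mode $\nu$ there is $\epsilon_\nu\in\{+1,-1\}$ such that $$A_\nu(\sigma(z))=\epsilon_\nu A_\nu(z)\qquad\text{for all reset sites } z.$$ Then for each spectral mode $\nu$ and each reset site $z$ with $A_\nu(z)\neq 0$, $$P_\nu(z)=[1:\epsilon_\nu\kappa(z)],$$ where $P_\nu(z):=[A_\nu(z):B_\nu(z)]\in\mathbb{P}^1$.
   Context: Let $m\ge2$ and let $z_1,\dots,z_m$ be distinct points (the reset sites). For each mode index $\nu\in\{1,\dots,N\}$ and each reset site $z$ there are real spectral coefficients $A_\nu(z),B_\nu(z)$. $\mathbb{P}^1$ is the real projective line with homogeneous coordinates $[x:y]$. *)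

theory Defs
  imports Complex_Main
begin

definition proportional :: "real \<times> real \<Rightarrow> real \<times> real \<Rightarrow> bool" where
  "proportional p q \<longleftrightarrow>
     p \<noteq> (0, 0) \<and> q \<noteq> (0, 0) \<and> (\<exists>c. c \<noteq> 0 \<and> q = (c * fst p, c * snd p))"

lemma part_equivp_proportional: "part_equivp proportional"
proof (rule part_equivpI)
  show "\<exists>p. proportional p p"
    by (rule exI[of _ "(1, 0)"]) (auto simp: proportional_def intro: exI[of _ 1])
  show "symp proportional"
  proof (rule sympI)
    fix p q assume "proportional p q"
    then obtain c where c: "c \<noteq> 0" "q = (c * fst p, c * snd p)"
      and nz: "p \<noteq> (0, 0)" "q \<noteq> (0, 0)"
      unfolding proportional_def by blast
    have "p = (inverse c * fst q, inverse c * snd q)"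
      using c by (simp add: prod_eq_iff)
    then show "proportional q p"
      using c nz unfolding proportional_def by (metis inverse_nonzero_iff_nonzero)
  qed
  show "transp proportional"
  proof (rule transpI)
    fix p q r assume "proportional p q" "proportional q r"
    then obtain c d where "c \<noteq> 0" "q = (c * fst p, c * snd p)"
        "d \<noteq> 0" "r = (d * fst q, d * snd q)" "p \<noteq> (0, 0)" "r \<noteq> (0, 0)"
      unfolding proportional_def by blast
    then show "proportional p r"
      unfolding proportional_def by (intro conjI exI[of _ "d * c"]) auto
  qed
qed

text \<open>The real projective line: nonzero vectors of the plane up to nonzero scalars.
  The quotient is partial, since the zero vector represents no point.\<close>

quotient_type real_proj_line = "real \<times> real" / partial: proportional
  by (rule part_equivp_proportional)

text \<open>The point \<open>[x : y]\<close>. As usual this is meaningful only for \<open>(x, y) \<noteq> (0, 0)\<close>;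
  at \<open>(0, 0)\<close> the value is an unspecified point.\<close>

definition hom_coords :: "real \<Rightarrow> real \<Rightarrow> real_proj_line" where
  "hom_coords x y = abs_real_proj_line (x, y)"

lemma hom_coords_eq_iff:
  assumes "(x, y) \<noteq> (0, 0)" and "(x', y') \<noteq> (0, 0)"
  shows "hom_coords x y = hom_coords x' y' \<longleftrightarrow> (\<exists>c. c \<noteq> 0 \<and> x' = c * x \<and> y' = c * y)"
proof -
  have refl: "proportional p p" if "p \<noteq> (0, 0)" for p
    using that by (auto simp: proportional_def intro: exI[of _ 1])
  have "hom_coords x y = hom_coords x' y' \<longleftrightarrow> proportional (x, y) (x', y')"
    unfolding hom_coords_def
    using Quotient3_rel[OF Quotient3_real_proj_line, of "(x, y)" "(x', y')"]
      refl[OF assms(1)] refl[OF assms(2)] by blast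
  then show ?thesis
    using assms by (auto simp: proportional_def)
qed

definition spectral_point ::
  "(nat \<Rightarrow> 'a \<Rightarrow> real) \<Rightarrow> (nat \<Rightarrow> 'a \<Rightarrow> real) \<Rightarrow> nat \<Rightarrow> 'a \<Rightarrow> real_proj_line" where
  "spectral_point A B \<nu> z = hom_coords (A \<nu> z) (B \<nu> z)"

end

theory Submission
  imports Defs
begin

text \<open>The coupling relation expresses \<open>B \<nu> z\<close> through the amplitude at
  \<open>\<sigma> z\<close>, and parity brings that amplitude back to \<open>z\<close> at the cost
  of the sign \<open>\<epsilon> \<nu>\<close>. Hence the vector (\<open>A \<nu> z\<close>,
  \<open>B \<nu> z\<close>) is \<open>A \<nu> z\<close> times (1,
  \<open>\<epsilon> \<nu> * \<kappa> z\<close>), and a nonzero scalar does not change a projective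
  point.\<close>

theorem lemma4p1:
  fixes m N :: nat
    and site :: "nat \<Rightarrow> 'a"
    and Z :: "'a set"
    and A B :: "nat \<Rightarrow> 'a \<Rightarrow> real"
    and \<sigma> :: "'a \<Rightarrow> 'a"
    and \<kappa> :: "'a \<Rightarrow> real"
    and \<epsilon> :: "nat \<Rightarrow> real"
  assumes "m \<ge> 2"
    and "inj_on site {1..m}"
    and "Z = site ` {1..m}"
    and "\<And>z. z \<in> Z \<Longrightarrow> \<sigma> z \<in> Z"
    and "\<And>z. z \<in> Z \<Longrightarrow> \<sigma> (\<sigma> z) = z"
    and "\<exists>z\<in>Z. \<sigma> z \<noteq> z"
    and "\<And>z. z \<in> Z \<Longrightarrow> \<kappa> z > 0"
    and "\<And>\<nu> z. \<nu> \<in> {1..N} \<Longrightarrow> z \<in> Z \<Longrightarrow> B \<nu> z = \<kappa> z * A \<nu> (\<sigma> z)"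
    and "\<And>\<nu>. \<nu> \<in> {1..N} \<Longrightarrow> \<epsilon> \<nu> \<in> {1, -1}"
    and "\<And>\<nu> z. \<nu> \<in> {1..N} \<Longrightarrow> z \<in> Z \<Longrightarrow> A \<nu> (\<sigma> z) = \<epsilon> \<nu> * A \<nu> z"
  shows "\<forall>\<nu>\<in>{1..N}. \<forall>z\<in>Z. A \<nu> z \<noteq> 0 \<longrightarrow>
           spectral_point A B \<nu> z = hom_coords 1 (\<epsilon> \<nu> * \<kappa> z)"
proof (intro ballI impI)
  fix \<nu> z
  assume \<nu>: "\<nu> \<in> {1..N}" and z: "z \<in> Z" and nz: "A \<nu> z \<noteq> 0"
  \<comment> \<open>Substituting parity into the coupling eliminates \<open>\<sigma> z\<close>; the
    factor \<open>A \<nu> z\<close> is kept in front as the future scalar.\<close>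
  have "B \<nu> z = A \<nu> z * (\<epsilon> \<nu> * \<kappa> z)"
    using assms(8,10)[OF \<nu> z] by simp
  \<comment> \<open>With the normalized point on the left, the scalar required by
    \<open>hom_coords_eq_iff\<close> is \<open>A \<nu> z\<close> itself rather than its inverse.
    Both pairs are nonzero because their first entries, 1 and \<open>A \<nu> z\<close>, are.\<close>
  then have "hom_coords 1 (\<epsilon> \<nu> * \<kappa> z) = hom_coords (A \<nu> z) (B \<nu> z)"
    using nz by (subst hom_coords_eq_iff) auto
  then show "spectral_point A B \<nu> z = hom_coords 1 (\<epsilon> \<nu> * \<kappa> z)"
    by (simp add: spectral_point_def)
qed

end
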